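(* Let $d,k$ be positive integers and let $M$ be a loopless matroid with $\dim\mathcal{I}(M)=d-1$ and $|\tilde\chi(\mathcal{I}(M))|=k$. Then \begin{enumerate} \item $h_i(\mathcal{I}(M))\le \binom{d}{i}+(k-1)\binom{d-1}{i-1}$ for $0\le i\le d$; \item $f_i(\mathcal{I}(M))\le \binom{d}{i+1}2^{i+1}+(k-1)\binom{d-1}{i}2^{i}$ for $-1\le i\le d-1$. \end{enumerate} Furthermore these inequalities are tight: there is a loopless matroid $M$ with $\dim\mathcal{I}(M)=d-1$ and $|\tilde\chi(\mathcal{I}(M))|=k$ attaining equality in all of them.
   Context: $\mathcal{I}(M)$ is the independence complex of $M$ (faces are the independent sets). $f_i$ denotes the number of $i$-dimensional faces (cardinality $i+1$), with $f_{-1}=1$; the $h$-vector of a $(d-1)$-dimensional complex is defined by $\sum_{i=0}^d h_i t^i=\sum_{i=0}^d f_{i-1}t^i(1-t)^{d-i}$. $\tilde\chi$ is the reduced Euler characteristic. Binomial coefficients $\binom{n}{j}$ with $j<0$ are $0$. *)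

theory Defs
  imports Complex_Main "HOL-Computational_Algebra.Polynomial"
begin

locale matroid =
  fixes carrier :: "'a set" and indep :: "'a set \<Rightarrow> bool"
  assumes carrier_finite: "finite carrier"
    and indep_subset_carrier: "indep X \<Longrightarrow> X \<subseteq> carrier"
    and indep_empty: "indep {}"
    and indep_subset: "indep X \<Longrightarrow> Y \<subseteq> X \<Longrightarrow> indep Y"
    and augment: "indep X \<Longrightarrow> indep Y \<Longrightarrow> card X < card Y \<Longrightarrow>
      \<exists>y\<in>Y - X. indep (insert y X)"

definition loopless :: "'a set \<Rightarrow> ('a set \<Rightarrow> bool) \<Rightarrow> bool" where
  "loopless carrier indep \<longleftrightarrow> (\<forall>e\<in>carrier. indep {e})"

text \<open>A finite simplicial complex is represented by its set of faces, including the empty face.\<close>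

definition independence_complex :: "('a set \<Rightarrow> bool) \<Rightarrow> 'a set set" where
  "independence_complex indep = {X. indep X}"

definition face_dim :: "'a set \<Rightarrow> int" where
  "face_dim F = int (card F) - 1"

definition complex_dim :: "'a set set \<Rightarrow> int" where
  "complex_dim \<Delta> = Max (face_dim ` \<Delta>)"

definition f_vec :: "'a set set \<Rightarrow> int \<Rightarrow> nat" where
  "f_vec \<Delta> i = card {F \<in> \<Delta>. face_dim F = i}"

text \<open>The polynomials \<open>[:0, 1:]\<close> and \<open>[:1, -1:]\<close> are \<open>t\<close> and \<open>1 - t\<close>.\<close>

definition h_poly :: "'a set set \<Rightarrow> int poly" where
  "h_poly \<Delta> = (let d = nat (complex_dim \<Delta> + 1) in
     \<Sum>i\<le>d. of_nat (f_vec \<Delta> (int i - 1)) * [:0, 1:] ^ i * [:1, -1:] ^ (d - i))"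

definition h_vec :: "'a set set \<Rightarrow> nat \<Rightarrow> int" where
  "h_vec \<Delta> i = coeff (h_poly \<Delta>) i"

text \<open>The summation index \<open>j\<close> is the cardinality of the faces, so their dimension is \<open>j - 1\<close>, and
  \<open>(-1) ^ (j + 1)\<close> equals \<open>(-1)\<close> to the power \<open>j - 1\<close>.\<close>

definition reduced_euler_char :: "'a set set \<Rightarrow> int" where
  "reduced_euler_char \<Delta> = (let d = nat (complex_dim \<Delta> + 1) in
     \<Sum>j\<le>d. (- 1) ^ (j + 1) * int (f_vec \<Delta> (int j - 1)))"

text \<open>Binomial coefficients with an integer lower index, zero when that index is negative.\<close>

definition binom :: "nat \<Rightarrow> int \<Rightarrow> real" where
  "binom n j = (if j < 0 then 0 else real (n choose nat j))"

end

theory Submission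
  imports Defs
begin

text \<open>
  For a family \<open>F\<close> of independent sets of rank \<open>d\<close> let \<open>G\<^sub>a(F)\<close> be the sum of
  \<open>t\<^bsup>|X|\<^esup> (1 - (1 - a) t)\<^bsup>d - |X|\<^esup>\<close> over \<open>X \<in> F\<close>; it is the \<open>h\<close>-polynomial for
  \<open>a = 0\<close> and the \<open>f\<close>-polynomial for \<open>a = 1\<close>. It satisfies \<open>G\<^sub>a(F) = G\<^sub>a(F - e) + t G\<^sub>a(F / e)\<close>
  if \<open>e\<close> is neither a loop nor a coloop, and \<open>G\<^sub>a(F) = (1 + a t) G\<^sub>a(F / e)\<close> if \<open>e\<close> is a coloop.
  By induction along these recursions \<open>G\<^sub>a(F)\<close> is bounded coefficientwise by
  \<open>(1 + (1 + a) t)\<^bsup>d\<^esup> + (k - 1) t (1 + (1 + a) t)\<^bsup>d - 1\<^esup>\<close>, where \<open>k\<close> is the leading coefficient of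
  \<open>G\<^sub>0(F)\<close>. Taking the leading coefficient, rather than the coefficient of \<open>t\<^bsup>d\<^esup>\<close>, keeps the
  statement meaningful in the presence of coloops, which do occur in deletions; the induction then
  only needs that the leading coefficient does not grow when a non-coloop is deleted. Without coloops it
  is the coefficient of \<open>t\<^bsup>d\<^esup>\<close>, that is, the absolute value of the reduced Euler characteristic.
  Equality holds for the direct sum of \<open>d - 1\<close> copies of \<open>U\<^sub>1\<^sub>,\<^sub>2\<close> and one \<open>U\<^bsub>1,k+1\<^esub>\<close>.
\<close>

section \<open>Polynomials with nonnegative coefficients\<close>

text \<open>A coefficientwise bound of p by q is phrased as \<open>coeffs_nonneg (q - p)\<close>, so
  that it can be proved by rewriting the difference as sums and products of such
  polynomials.\<close>

definition coeffs_nonneg :: "int poly \<Rightarrow> bool" where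
  "coeffs_nonneg p \<longleftrightarrow> (\<forall>i. 0 \<le> coeff p i)"

lemma coeffs_nonneg_add: "coeffs_nonneg p \<Longrightarrow> coeffs_nonneg q \<Longrightarrow> coeffs_nonneg (p + q)"
  by (simp add: coeffs_nonneg_def)

lemma coeffs_nonneg_mult: "coeffs_nonneg p \<Longrightarrow> coeffs_nonneg q \<Longrightarrow> coeffs_nonneg (p * q)"
  by (simp add: coeffs_nonneg_def coeff_mult sum_nonneg)

lemma coeffs_nonneg_0: "coeffs_nonneg 0" and coeffs_nonneg_1: "coeffs_nonneg 1"
  by (simp_all add: coeffs_nonneg_def)

lemma coeffs_nonneg_power: "coeffs_nonneg p \<Longrightarrow> coeffs_nonneg (p ^ n)"
  by (induction n) (simp_all add: coeffs_nonneg_1 coeffs_nonneg_mult)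

lemma coeffs_nonneg_of_int: "0 \<le> c \<Longrightarrow> coeffs_nonneg (of_int c)"
  by (simp add: coeffs_nonneg_def of_int_poly coeff_pCons split: nat.split)

lemma coeffs_nonneg_linear: "0 \<le> b \<Longrightarrow> 0 \<le> c \<Longrightarrow> coeffs_nonneg [:b, c:]"
  by (simp add: coeffs_nonneg_def coeff_pCons split: nat.split)

lemmas coeffs_nonneg_intros = coeffs_nonneg_add coeffs_nonneg_mult coeffs_nonneg_0 coeffs_nonneg_1
  coeffs_nonneg_power coeffs_nonneg_of_int coeffs_nonneg_linear

section \<open>Matroids as set families: deletion, contraction and coloops\<close>

text \<open>The ground set is quantified away: deletion and contraction of e keep the same ground
  set and merely turn e into a loop, so inductions can run on the number of independent
  sets.\<close>

definition matroid_rank :: "nat \<Rightarrow> 'a set set \<Rightarrow> bool" where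
  "matroid_rank d F \<longleftrightarrow>
     (\<exists>E. matroid E (\<lambda>X. X \<in> F)) \<and> (\<exists>X\<in>F. card X = d) \<and> (\<forall>X\<in>F. card X \<le> d)"

definition deletion :: "'a \<Rightarrow> 'a set set \<Rightarrow> 'a set set" where
  "deletion e F = {X \<in> F. e \<notin> X}"

definition contraction :: "'a \<Rightarrow> 'a set set \<Rightarrow> 'a set set" where
  "contraction e F = {X. e \<notin> X \<and> insert e X \<in> F}"

text \<open>For a matroid this says that the independence complex is a cone with apex \<open>e\<close>, or equivalently
  that every basis contains \<open>e\<close>.\<close>

definition coloop :: "'a \<Rightarrow> 'a set set \<Rightarrow> bool" where
  "coloop e F \<longleftrightarrow> (\<forall>X\<in>F. insert e X \<in> F)"

lemma deletion_contraction_commute: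
  "c \<noteq> e \<Longrightarrow> contraction c (deletion e F) = deletion e (contraction c F)"
  by (auto simp: deletion_def contraction_def)

lemma deletion_subset_contraction_coloop: "coloop e F \<Longrightarrow> deletion e F \<subseteq> contraction e F"
  by (auto simp: deletion_def contraction_def coloop_def)

context
  fixes d :: nat and F :: "'a set set"
  assumes F: "matroid_rank d F"
begin

lemma family_finite: "finite F"
proof -
  obtain E where "matroid E (\<lambda>X. X \<in> F)" using F by (auto simp: matroid_rank_def)
  then interpret matroid E "\<lambda>X. X \<in> F" .
  have "F \<subseteq> Pow E" using indep_subset_carrier by blast
  then show ?thesis using carrier_finite finite_subset by auto
qed

lemma member_finite: "X \<in> F \<Longrightarrow> finite X"
  using F unfolding matroid_rank_def matroid_def by (meson finite_subset)

lemma empty_member: "{} \<in> F"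
  using F unfolding matroid_rank_def matroid_def by auto

lemma member_subset: "X \<in> F \<Longrightarrow> Y \<subseteq> X \<Longrightarrow> Y \<in> F"
  using F unfolding matroid_rank_def matroid_def by blast

lemma member_augment: "X \<in> F \<Longrightarrow> Y \<in> F \<Longrightarrow> card X < card Y \<Longrightarrow> \<exists>y\<in>Y - X. insert y X \<in> F"
  using F unfolding matroid_rank_def matroid_def by blast

lemma member_card_le: "X \<in> F \<Longrightarrow> card X \<le> d"
  using F unfolding matroid_rank_def by blast

lemma obtain_basis: obtains B where "B \<in> F" "card B = d"
  using F unfolding matroid_rank_def by blast

text \<open>Iterated augmentation. The inclusion of Z in X \<union> Y is what later controls which
  elements a completed basis may contain.\<close>

lemma member_extend:
  assumes "X \<in> F" "Y \<in> F" "card X \<le> card Y"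
  shows "\<exists>Z\<in>F. X \<subseteq> Z \<and> Z \<subseteq> X \<union> Y \<and> card Z = card Y"
  using assms
proof (induction "card Y - card X" arbitrary: X)
  case 0
  then show ?case by auto
next
  case (Suc n)
  have "card X < card Y" using Suc.hyps(2) by linarith
  then obtain y where y: "y \<in> Y - X" "insert y X \<in> F"
    using member_augment[OF Suc.prems(1,2)] by blast
  have "card (insert y X) = Suc (card X)"
    using y member_finite Suc.prems by auto
  then obtain Z where "Z \<in> F" "insert y X \<subseteq> Z" "Z \<subseteq> insert y X \<union> Y" "card Z = card Y"
    using Suc.hyps(1)[of "insert y X"] Suc.hyps(2) Suc.prems y by fastforce
  then show ?case using y by auto
qed

text \<open>The rank survives because an independent X that cannot be enlarged by e extends to a
  basis, and this basis must avoid e.\<close>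

lemma matroid_rank_deletion:
  assumes "\<not> coloop e F"
  shows "matroid_rank d (deletion e F)"
proof -
  obtain E where E: "matroid E (\<lambda>X. X \<in> F)" using F by (auto simp: matroid_rank_def)
  then interpret matroid E "\<lambda>X. X \<in> F" .
  have "matroid E (\<lambda>X. X \<in> deletion e F)"
  proof
    fix X Y assume "X \<in> deletion e F" "Y \<in> deletion e F" "card X < card Y"
    then show "\<exists>y\<in>Y - X. insert y X \<in> deletion e F"
      using augment[of X Y] by (auto simp: deletion_def)
  qed (use carrier_finite indep_subset_carrier indep_empty indep_subset in \<open>auto simp: deletion_def\<close>)
  moreover obtain X where X: "X \<in> F" "insert e X \<notin> F" using assms by (auto simp: coloop_def)
  obtain B where B: "B \<in> F" "card B = d" by (rule obtain_basis)
  obtain Z where Z: "Z \<in> F" "X \<subseteq> Z" "card Z = d"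
    using member_extend[OF X(1) B(1)] B(2) member_card_le[OF X(1)] by auto
  then have "e \<notin> Z" using X member_subset[of Z "insert e X"] by auto
  then have "Z \<in> deletion e F" using Z by (simp add: deletion_def)
  ultimately show ?thesis using Z member_card_le
    by (auto simp: matroid_rank_def deletion_def)
qed

text \<open>Contracting a nonloop creates no coloops. If a basis B avoids c, completing {e} inside B
  gives a basis Z with e \<in> Z and c \<notin> Z; were c a coloop of the contraction, Z together
  with c would be independent of size d + 1.\<close>

lemma coloop_contraction:
  assumes e: "{e} \<in> F" and c: "coloop c (contraction e F)"
  shows "coloop c F"
proof (rule ccontr)
  assume nc: "\<not> coloop c F"
  obtain B where B: "B \<in> F" "c \<notin> B" "card B = d"
    using matroid_rank_deletion[OF nc] by (auto simp: matroid_rank_def deletion_def)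
  have "{} \<in> contraction e F" using e by (simp add: contraction_def)
  with c have "{c} \<in> contraction e F" by (auto simp: coloop_def)
  then have "c \<noteq> e" by (auto simp: contraction_def)
  have "card {e} \<le> card B" using member_card_le[OF e] B by simp
  then obtain Z where Z: "Z \<in> F" "e \<in> Z" "Z \<subseteq> insert e B" "card Z = d"
    using member_extend[OF e B(1)] B by auto
  then have "Z - {e} \<in> contraction e F" by (simp add: contraction_def insert_absorb)
  with c have "insert e (insert c (Z - {e})) \<in> F" by (auto simp: coloop_def contraction_def)
  moreover have "insert e (insert c (Z - {e})) = insert c Z" using Z by auto
  moreover have "card (insert c Z) = Suc d"
    using Z B \<open>c \<noteq> e\<close> member_finite[of Z] by (subst card_insert_disjoint) auto
  ultimately show False using member_card_le by force
qed

lemma card_deletion_less: "{e} \<in> F \<Longrightarrow> card (deletion e F) < card F"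
  by (rule psubset_card_mono[OF family_finite]) (auto simp: deletion_def)

lemma contraction_eq_image: "contraction e F = (\<lambda>X. X - {e}) ` (F - deletion e F)"
proof -
  have "X \<in> (\<lambda>X. X - {e}) ` (F - deletion e F)" if "X \<in> contraction e F" for X
    by (rule image_eqI[of _ _ "insert e X"]) (use that in \<open>auto simp: contraction_def deletion_def\<close>)
  moreover have "X - {e} \<in> contraction e F" if "X \<in> F - deletion e F" for X
    using that by (auto simp: contraction_def deletion_def insert_absorb)
  ultimately show ?thesis by blast
qed

lemma card_contraction_less: "card (contraction e F) < card F"
proof -
  have "card (contraction e F) \<le> card (F - deletion e F)"
    unfolding contraction_eq_image by (rule card_image_le) (simp add: family_finite)
  also have "\<dots> < card F"
    by (rule psubset_card_mono[OF family_finite]) (use empty_member in \<open>auto simp: deletion_def\<close>)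
  finally show ?thesis .
qed

end

lemma matroid_rank_contraction:
  assumes F: "matroid_rank (Suc d) F" and e: "{e} \<in> F"
  shows "matroid_rank d (contraction e F)"
proof -
  obtain E where E: "matroid E (\<lambda>X. X \<in> F)" using F by (auto simp: matroid_rank_def)
  then interpret matroid E "\<lambda>X. X \<in> F" .
  have card: "card (insert e X) = Suc (card X)" if "X \<in> contraction e F" for X
    using that member_finite[OF F, of "insert e X"] by (auto simp: contraction_def)
  have "matroid E (\<lambda>X. X \<in> contraction e F)"
  proof
    fix X Y assume XY: "X \<in> contraction e F" "Y \<in> contraction e F" "card X < card Y"
    then obtain y where "y \<in> insert e Y - insert e X" "insert y (insert e X) \<in> F"
      using augment[of "insert e X" "insert e Y"] card by (auto simp: contraction_def)
    then show "\<exists>y\<in>Y - X. insert y X \<in> contraction e F"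
      using XY by (auto simp: contraction_def insert_commute)
  next
    fix X Y assume "X \<in> contraction e F" "Y \<subseteq> X"
    then show "Y \<in> contraction e F"
      using indep_subset[of "insert e X" "insert e Y"] by (auto simp: contraction_def)
  qed (use carrier_finite indep_subset_carrier e in \<open>auto simp: contraction_def\<close>)
  moreover have "card X \<le> d" if "X \<in> contraction e F" for X
    using card[OF that] that member_card_le[OF F, of "insert e X"] by (auto simp: contraction_def)
  moreover obtain B where B: "B \<in> F" "card B = Suc d" by (rule obtain_basis[OF F])
  obtain Z where Z: "Z \<in> F" "e \<in> Z" "card Z = Suc d"
    using member_extend[OF F e B(1)] B by auto
  then have "Z - {e} \<in> contraction e F" "card (Z - {e}) = d"
    by (auto simp: contraction_def insert_absorb)
  ultimately show ?thesis by (auto simp: matroid_rank_def)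
qed

lemma matroid_rank_0: "matroid_rank 0 F \<Longrightarrow> F = {{}}"
  using member_card_le[of 0 F] member_finite[of 0 F] empty_member[of 0 F] by fastforce

lemma matroid_rank_Suc_nonloop:
  assumes F: "matroid_rank (Suc d) F"
  obtains e where "{e} \<in> F"
proof -
  obtain B where B: "B \<in> F" "card B = Suc d" by (rule obtain_basis[OF F])
  then obtain e where "e \<in> B" by fastforce
  then show ?thesis using that member_subset[OF F B(1), of "{e}"] by auto
qed

lemma coloop_nonloop: "matroid_rank d F \<Longrightarrow> coloop e F \<Longrightarrow> {e} \<in> F"
  using empty_member by (auto simp: coloop_def)

lemma coloop_rank_pos:
  assumes "matroid_rank d F" "coloop e F"
  obtains d' where "d = Suc d'"
  using member_card_le[OF assms(1) coloop_nonloop[OF assms]] by (cases d) auto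

section \<open>The polynomial interpolating between h and f, and its recursions\<close>

definition face_poly :: "int \<Rightarrow> nat \<Rightarrow> 'a set set \<Rightarrow> int poly" where
  "face_poly a d F = (\<Sum>X\<in>F. [:0, 1:] ^ card X * [:1, a - 1:] ^ (d - card X))"

lemma face_poly_rank_0: "face_poly a 0 {{}} = 1"
  by (simp add: face_poly_def)

text \<open>Faces are split by whether they contain e. Removing e lowers the cardinality and the
  rank together, so the exponent of the second factor is unchanged and one factor t comes
  out.\<close>

lemma face_poly_nonloop:
  assumes F: "matroid_rank (Suc d) F"
  shows "face_poly a (Suc d) F = face_poly a (Suc d) (deletion e F)
    + [:0, 1:] * face_poly a d (contraction e F)"
proof -
  let ?g = "\<lambda>X. [:0, 1:] ^ card X * [:1, a - 1:] ^ (Suc d - card X)"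
  have fin: "finite F" by (rule family_finite[OF F])
  have "sum ?g F = sum ?g (F - deletion e F) + sum ?g (deletion e F)"
    by (rule sum.subset_diff) (auto simp: fin deletion_def)
  moreover have "sum ?g (F - deletion e F) = [:0, 1:] * face_poly a d (contraction e F)"
    unfolding face_poly_def sum_distrib_left
  proof (rule sum.reindex_bij_witness[of _ "insert e" "\<lambda>X. X - {e}"])
    fix X assume X: "X \<in> F - deletion e F"
    then have "finite X" "e \<in> X" using member_finite[OF F] by (auto simp: deletion_def)
    then have "card X = Suc (card (X - {e}))" by (rule card.remove)
    then show "[:0, 1:] * ([:0, 1:] ^ card (X - {e}) * [:1, a - 1:] ^ (d - card (X - {e}))) = ?g X"
      by (simp only: power_Suc diff_Suc_Suc mult.assoc)
  qed (auto simp: deletion_def contraction_def insert_absorb)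
  ultimately show ?thesis by (simp add: face_poly_def)
qed

text \<open>For a coloop, deletion and contraction are the same family. Measured against rank d + 1
  it gains a factor 1 + (a - 1) t, to which the contraction term adds t.\<close>

lemma face_poly_coloop:
  assumes F: "matroid_rank (Suc d) F" and e: "coloop e F"
  shows "face_poly a (Suc d) F = [:1, a:] * face_poly a d (contraction e F)"
proof -
  have eq: "deletion e F = contraction e F"
    using deletion_subset_contraction_coloop[OF e] member_subset[OF F]
    by (auto simp: deletion_def contraction_def)
  have "card X \<le> d" if "X \<in> contraction e F" for X
    using member_card_le[OF matroid_rank_contraction[OF F coloop_nonloop[OF F e]]] that by simp
  then have "face_poly a (Suc d) (contraction e F) = [:1, a - 1:] * face_poly a d (contraction e F)"
    unfolding face_poly_def sum_distrib_left
    by (intro sum.cong) (simp_all only: Suc_diff_le power_Suc mult.left_commute)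
  moreover have "[:1, a:] = [:1, a - 1:] + [:0, 1:]" by simp
  ultimately show ?thesis
    unfolding face_poly_nonloop[OF F, of a e] eq by (simp only: distrib_right)
qed

lemma degree_face_poly:
  assumes F: "matroid_rank d F"
  shows "degree (face_poly a d F) \<le> d"
  unfolding face_poly_def
proof (rule degree_sum_le[OF family_finite[OF F]])
  fix X assume "X \<in> F"
  then have "card X \<le> d" by (rule member_card_le[OF F])
  have "degree ([:0, 1:] ^ card X * [:1, a - 1:] ^ (d - card X))
      \<le> degree ([:0, 1::int:] ^ card X) + degree ([:1, a - 1:] ^ (d - card X))"
    by (simp add: degree_mult_le)
  also have "\<dots> \<le> 1 * card X + 1 * (d - card X)"
    by (intro add_mono order.trans[OF degree_power_le] mult_right_mono) auto
  finally show "degree ([:0, 1:] ^ card X * [:1, a - 1:] ^ (d - card X)) \<le> d"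
    using \<open>card X \<le> d\<close> by simp
qed

text \<open>For a = 0 the individual summands have negative coefficients; positivity comes from the
  two recursions, whose multipliers t and 1 + a t are nonnegative.\<close>

lemma face_poly_nonneg:
  assumes "matroid_rank d F" "0 \<le> a"
  shows "coeffs_nonneg (face_poly a d F)"
  using assms
proof (induction "card F" arbitrary: F d rule: less_induct)
  case less
  note F = less.prems(1)
  show ?case
  proof (cases d)
    case 0
    then show ?thesis using matroid_rank_0 F face_poly_rank_0 coeffs_nonneg_1 by metis
  next
    case (Suc d')
    then have F': "matroid_rank (Suc d') F" using F by simp
    obtain e where e: "{e} \<in> F" by (rule matroid_rank_Suc_nonloop[OF F'])
    have con: "coeffs_nonneg (face_poly a d' (contraction e F))"
      using less.hyps[OF card_contraction_less[OF F] matroid_rank_contraction[OF F' e]] less.prems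
      by simp
    show ?thesis
    proof (cases "coloop e F")
      case True
      then show ?thesis
        unfolding Suc face_poly_coloop[OF F' True]
        by (intro coeffs_nonneg_intros con less.prems) auto
    next
      case False
      have "coeffs_nonneg (face_poly a d (deletion e F))"
        using less.hyps[OF card_deletion_less[OF F e] matroid_rank_deletion[OF F False]] less.prems
        by simp
      then show ?thesis
        unfolding Suc face_poly_nonloop[OF F', of a e]
        by (intro coeffs_nonneg_intros con) auto
    qed
  qed
qed

section \<open>The leading coefficient of the h-polynomial under deletion and contraction\<close>

text \<open>Coloops do not change the polynomial \<open>face_poly 0\<close>, so this is the last entry of the \<open>h\<close>-vector after
  contracting all coloops.\<close>

abbreviation top_h :: "nat \<Rightarrow> 'a set set \<Rightarrow> int" where
  "top_h d F \<equiv> lead_coeff (face_poly 0 d F)"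

lemma coeff_Suc_face_poly:
  assumes "matroid_rank (Suc d) F"
  shows "coeff (face_poly 0 (Suc d) F) (Suc i)
    = coeff (face_poly 0 (Suc d) (deletion e F)) (Suc i) + coeff (face_poly 0 d (contraction e F)) i"
  unfolding face_poly_nonloop[OF assms, of 0 e] by simp

text \<open>Contracting a nonloop preserves the absence of coloops, so the contraction already
  contributes at least 1; the deletion contributes a nonnegative amount.\<close>

lemma coeff_top_ge_1:
  assumes "matroid_rank d F" "\<And>e. \<not> coloop e F"
  shows "1 \<le> coeff (face_poly 0 d F) d"
  using assms
proof (induction d arbitrary: F)
  case 0
  then show ?case using matroid_rank_0[of F] by (simp add: face_poly_rank_0)
next
  case (Suc d)
  note F = Suc.prems(1)
  obtain e where e: "{e} \<in> F" by (rule matroid_rank_Suc_nonloop[OF F])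
  have "1 \<le> coeff (face_poly 0 d (contraction e F)) d"
    using Suc.IH[OF matroid_rank_contraction[OF F e]] coloop_contraction[OF F e] Suc.prems(2) by blast
  moreover have "0 \<le> coeff (face_poly 0 (Suc d) (deletion e F)) (Suc d)"
    using face_poly_nonneg[OF matroid_rank_deletion[OF F Suc.prems(2)], of 0]
    by (auto simp: coeffs_nonneg_def)
  ultimately show ?case unfolding coeff_Suc_face_poly[OF F, of d e] by simp
qed

lemma top_h_no_coloops:
  assumes "matroid_rank d F" "\<And>e. \<not> coloop e F"
  shows "top_h d F = coeff (face_poly 0 d F) d"
proof -
  have "degree (face_poly 0 d F) = d"
    using degree_face_poly[OF assms(1), of 0] le_degree[of "face_poly 0 d F" d] coeff_top_ge_1[OF assms]
    by force
  then show ?thesis by simp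
qed

lemma top_h_coloop:
  assumes "matroid_rank (Suc d) F" "coloop e F"
  shows "top_h (Suc d) F = top_h d (contraction e F)"
  using face_poly_coloop[OF assms, of 0] by simp

lemma top_h_ge_1:
  assumes "matroid_rank d F"
  shows "1 \<le> top_h d F"
  using assms
proof (induction d arbitrary: F)
  case 0
  then show ?case using matroid_rank_0[of F] by (simp add: face_poly_rank_0)
next
  case (Suc d)
  show ?case
  proof (cases "\<exists>c. coloop c F")
    case True
    then obtain c where c: "coloop c F" by blast
    then show ?thesis
      using top_h_coloop[OF Suc.prems c]
        Suc.IH[OF matroid_rank_contraction[OF Suc.prems coloop_nonloop[OF Suc.prems c]]] by simp
  next
    case False
    then show ?thesis
      using top_h_no_coloops[OF Suc.prems] coeff_top_ge_1[OF Suc.prems] by simp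
  qed
qed

text \<open>Neither matroid has coloops, so both sides are top coefficients, and by the recursion
  they differ by a nonnegative coefficient of the deletion.\<close>

lemma top_h_contraction_le:
  assumes F: "matroid_rank (Suc d) F" and nc: "\<And>c. \<not> coloop c F" and e: "{e} \<in> F"
  shows "top_h d (contraction e F) \<le> top_h (Suc d) F"
proof -
  have "0 \<le> coeff (face_poly 0 (Suc d) (deletion e F)) (Suc d)"
    using face_poly_nonneg[OF matroid_rank_deletion[OF F nc], of 0]
    by (auto simp: coeffs_nonneg_def)
  moreover have "\<not> coloop c (contraction e F)" for c
    using coloop_contraction[OF F e] nc by blast
  ultimately show ?thesis
    using coeff_Suc_face_poly[OF F, of d e] top_h_no_coloops[OF F nc]
      top_h_no_coloops[OF matroid_rank_contraction[OF F e]] by simp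
qed

text \<open>If deleting \<open>e\<close> creates a coloop \<open>c\<close>, both sides are compared through the contraction of \<open>c\<close>.\<close>

lemma top_h_deletion_le:
  assumes "matroid_rank d F" "\<not> coloop e F"
  shows "top_h d (deletion e F) \<le> top_h d F"
  using assms
proof (induction "card F" arbitrary: F d rule: less_induct)
  case less
  note F = less.prems(1) and e = less.prems(2)
  have D: "matroid_rank d (deletion e F)" by (rule matroid_rank_deletion[OF F e])
  have step: "top_h d' (deletion e (contraction c F)) \<le> top_h d' (contraction c F)"
    if "d = Suc d'" "{c} \<in> F" for c d'
  proof (rule less.hyps[OF card_contraction_less[OF F]])
    show "matroid_rank d' (contraction c F)" by (rule matroid_rank_contraction[OF F[unfolded that(1)] that(2)])
    show "\<not> coloop e (contraction c F)" using coloop_contraction[OF F that(2)] e by blast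
  qed
  have top_del: "top_h d (deletion e F) = top_h d' (deletion e (contraction c F))"
    if "d = Suc d'" "coloop c (deletion e F)" for c d'
  proof -
    have "c \<noteq> e" using coloop_nonloop[OF D that(2)] by (auto simp: deletion_def)
    then have "contraction c (deletion e F) = deletion e (contraction c F)"
      by (rule deletion_contraction_commute)
    with top_h_coloop[OF D[unfolded that(1)] that(2)] that(1) show ?thesis by simp
  qed
  \<comment> \<open>A coloop of F differs from e and stays a coloop after deleting e, so contracting
    it on both sides reduces to a smaller family. When no coloops occur at all, both sides are
    coefficients of t^d and the recursion compares them directly.\<close>
  consider (loop) "{e} \<notin> F" | (coloop) c where "coloop c F"
    | (series) c where "{e} \<in> F" "\<And>c. \<not> coloop c F" "coloop c (deletion e F)"
    | (no_coloop) "{e} \<in> F" "\<And>c. \<not> coloop c F" "\<And>c. \<not> coloop c (deletion e F)"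
    by blast
  then show ?case
  proof cases
    case loop
    have "{e} \<subseteq> X" if "e \<in> X" for X using that by simp
    then have "deletion e F = F"
      using loop member_subset[OF F, of _ "{e}"] by (auto simp: deletion_def)
    then show ?thesis by simp
  next
    case coloop
    then obtain d' where d: "d = Suc d'" using coloop_rank_pos[OF F] by blast
    have "c \<noteq> e" using coloop e by blast
    then have "coloop c (deletion e F)" using coloop by (auto simp: coloop_def deletion_def)
    then show ?thesis
      using top_del[OF d] step[OF d coloop_nonloop[OF F coloop]]
        top_h_coloop[OF F[unfolded d] coloop] d by simp
  next
    case series
    then obtain d' where d: "d = Suc d'" using coloop_rank_pos[OF D] by blast
    have c: "{c} \<in> F" using coloop_nonloop[OF D series(3)] by (simp add: deletion_def)
    show ?thesis
      using top_del[OF d series(3)] step[OF d c]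
        top_h_contraction_le[OF F[unfolded d] series(2) c] d by simp
  next
    case no_coloop
    obtain d' where d: "d = Suc d'"
      using member_card_le[OF F no_coloop(1)] by (cases d) auto
    have "0 \<le> coeff (face_poly 0 d' (contraction e F)) d'"
      using face_poly_nonneg[OF matroid_rank_contraction[OF F[unfolded d] no_coloop(1)], of 0]
      by (auto simp: coeffs_nonneg_def)
    then show ?thesis
      using top_h_no_coloops[OF F no_coloop(2)] top_h_no_coloops[OF D no_coloop(3)]
        coeff_Suc_face_poly[OF F[unfolded d], of d' e] d by simp
  qed
qed

section \<open>The bounding polynomial\<close>

text \<open>Rank 0 has its own clause since the exponent d - 1 makes no sense there; the only family
  of rank 0 is {{}}, whose polynomial is 1.\<close>

fun bound_poly :: "int \<Rightarrow> nat \<Rightarrow> int \<Rightarrow> int poly" where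
  "bound_poly a 0 k = 1"
| "bound_poly a (Suc d) k = [:1, 1 + a:] ^ Suc d + of_int (k - 1) * [:0, 1:] * [:1, 1 + a:] ^ d"

lemma bound_poly_nonneg: "0 \<le> a \<Longrightarrow> 1 \<le> k \<Longrightarrow> coeffs_nonneg (bound_poly a d k)"
  by (cases d) (auto intro!: coeffs_nonneg_intros simp del: of_int_diff power_Suc mult_pCons_left mult_pCons_right)

lemma bound_poly_mono:
  assumes "0 \<le> a" "k \<le> l"
  shows "coeffs_nonneg (bound_poly a d l - bound_poly a d k)"
proof (cases d)
  case (Suc d')
  have "bound_poly a d l - bound_poly a d k = of_int (l - k) * ([:0, 1:] * [:1, 1 + a:] ^ d')"
    unfolding Suc bound_poly.simps of_int_diff of_int_1 by algebra
  moreover have "coeffs_nonneg \<dots>" by (intro coeffs_nonneg_intros) (use assms in auto)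
  ultimately show ?thesis by (simp only:)
qed (simp add: coeffs_nonneg_0)

text \<open>For d > 0 the difference vanishes; the step from rank 0 to rank 1 leaves the surplus (k
  - 1) t.\<close>

lemma bound_poly_Suc:
  assumes "1 \<le> k"
  shows "coeffs_nonneg (bound_poly a (Suc d) k - [:1, 1 + a:] * bound_poly a d k)"
proof (cases d)
  case 0
  have "bound_poly a (Suc d) k - [:1, 1 + a:] * bound_poly a d k = of_int (k - 1) * [:0, 1:]"
    unfolding 0 bound_poly.simps by simp
  moreover have "coeffs_nonneg \<dots>" by (intro coeffs_nonneg_intros) (use assms in auto)
  ultimately show ?thesis by (simp only:)
next
  case (Suc d')
  have "bound_poly a (Suc d) k - [:1, 1 + a:] * bound_poly a d k = 0"
    unfolding Suc bound_poly.simps power_Suc by algebra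
  then show ?thesis by (simp only: coeffs_nonneg_0)
qed

lemma scaled_difference:
  fixes u w t c p :: "'b::comm_ring_1"
  shows "u = w + t \<Longrightarrow> c * (u * p) - (u * p + (c - 1) * t * p) = (c - 1) * p * w"
  by (simp add: algebra_simps)

text \<open>With u = 1 + (1 + a) t and w = u - t, the difference is (k - 1) u^(d - 1) w for d > 0.
  This lets the bound for a contraction be absorbed into a multiple of u^d.\<close>

lemma bound_poly_le:
  assumes "0 \<le> a" "1 \<le> k"
  shows "coeffs_nonneg (of_int k * [:1, 1 + a:] ^ d - bound_poly a d k)"
proof (cases d)
  case 0
  have "of_int k * [:1, 1 + a:] ^ d - bound_poly a d k = of_int (k - 1)" by (simp add: 0)
  then show ?thesis using assms by (auto intro!: coeffs_nonneg_intros simp del: of_int_diff)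
next
  case (Suc d')
  have "[:1, 1 + a:] = [:1, a:] + [:0, 1:]" by simp
  then have "of_int k * [:1, 1 + a:] ^ d - bound_poly a d k
    = of_int (k - 1) * [:1, 1 + a:] ^ d' * [:1, a:]"
    unfolding Suc bound_poly.simps power_Suc of_int_diff of_int_1
    by (rule scaled_difference)
  moreover have "coeffs_nonneg (of_int (k - 1) * [:1, 1 + a:] ^ d' * [:1, a:])"
    by (intro coeffs_nonneg_intros) (use assms in auto)
  ultimately show ?thesis by simp
qed

section \<open>The coefficientwise upper bound\<close>

text \<open>Three cases: F has a coloop; only the deletion has one; neither has one. In each, the
  difference is decomposed into visibly nonnegative terms.\<close>

theorem face_poly_le_bound_poly:
  assumes "matroid_rank d F" "0 \<le> a"
  shows "coeffs_nonneg (bound_poly a d (top_h d F) - face_poly a d F)"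
  using assms
proof (induction "card F" arbitrary: F d rule: less_induct)
  case less
  note F = less.prems(1) and a = less.prems(2)
  note k1 = top_h_ge_1[OF F]
  define t where "t = [:0, 1::int:]"
  define w where "w = [:1, a:]"
  define u where "u = [:1, 1 + a:]"
  have u: "u = w + t" by (simp add: t_def w_def u_def)
  have nn: "coeffs_nonneg t" "coeffs_nonneg w" "coeffs_nonneg u"
    using a by (auto simp: t_def w_def u_def intro!: coeffs_nonneg_linear)
  show ?case
  proof (cases d)
    case 0
    then show ?thesis using matroid_rank_0[of F] F by (simp add: face_poly_rank_0 coeffs_nonneg_0)
  next
    case (Suc d')
    then have F': "matroid_rank (Suc d') F" using F by simp
    define k where "k = top_h d F"
    let ?B = "bound_poly a"
    have con: "coeffs_nonneg (?B d' (top_h d' (contraction e F)) - face_poly a d' (contraction e F))"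
      if "{e} \<in> F" for e
      by (rule less.hyps[OF card_contraction_less[OF F] matroid_rank_contraction[OF F' that] a])
    have Suc_bound: "coeffs_nonneg (?B d k - u * ?B d' k)"
      unfolding Suc u_def by (rule bound_poly_Suc) (use k1 k_def in simp)
    show ?thesis
    proof (cases "\<exists>c. coloop c F")
      case True
      then obtain c where c: "coloop c F" by blast
      let ?g = "face_poly a d' (contraction c F)"
      have k: "k = top_h d' (contraction c F)" using top_h_coloop[OF F' c] Suc by (simp add: k_def)
      \<comment> \<open>The coloop multiplies the polynomial by w only, while the bound grows by at
        least u = w + t; the spare t yields the middle term.\<close>
      have "?B d k - face_poly a d F
          = (?B d k - u * ?B d' k) + t * ?B d' k + w * (?B d' k - ?g)"
        unfolding Suc face_poly_coloop[OF F' c, of a, folded w_def] u by algebra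
      also have "coeffs_nonneg \<dots>"
        by (intro coeffs_nonneg_intros nn Suc_bound bound_poly_nonneg a)
          (use con[OF coloop_nonloop[OF F c]] k k_def k1 in auto)
      finally show ?thesis by (simp add: k_def)
    next
      case False
      then have nc: "\<not> coloop c F" for c by blast
      obtain e where e: "{e} \<in> F" by (rule matroid_rank_Suc_nonloop[OF F'])
      let ?C = "contraction e F" and ?D = "deletion e F"
      have D: "matroid_rank d ?D" by (rule matroid_rank_deletion[OF F nc])
      have C: "matroid_rank d' ?C" by (rule matroid_rank_contraction[OF F' e])
      define l where "l = top_h d' ?C"
      have l1: "1 \<le> l" unfolding l_def by (rule top_h_ge_1[OF C])
      have lk: "l \<le> k" using top_h_contraction_le[OF F' nc e] Suc by (simp add: l_def k_def)
      note conC = con[OF e, folded l_def]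
      have split: "face_poly a d F = face_poly a d ?D + t * face_poly a d' ?C"
        unfolding Suc t_def by (rule face_poly_nonloop[OF F'])
      show ?thesis
      proof (cases "\<exists>c. coloop c ?D")
        case True
        then obtain c where c: "coloop c ?D" by blast
        let ?g = "face_poly a d' (contraction c ?D)"
        define m where "m = top_h d ?D"
        have m: "m = top_h d' (contraction c ?D)"
          unfolding m_def using top_h_coloop[OF _ c] D Suc by simp
        have mk: "m \<le> k" unfolding m_def k_def by (rule top_h_deletion_le[OF F nc])
        have D': "matroid_rank (Suc d') ?D" using D Suc by simp
        have "card (contraction c ?D) < card F"
          using card_contraction_less[OF D] card_deletion_less[OF F e] by (rule less_trans)
        then have conD: "coeffs_nonneg (?B d' m - ?g)"
          unfolding m
          by (rule less.hyps[OF _ matroid_rank_contraction[OF D' coloop_nonloop[OF D c]] a])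
        have gD: "face_poly a d ?D = w * ?g" unfolding Suc w_def by (rule face_poly_coloop[OF D' c])
        \<comment> \<open>Here u * \<open>?B d' k\<close> is split as w * \<open>?B d' k\<close> + t
          * \<open>?B d' k\<close>: the first part pays for the deletion, the second for the
          contraction, using m \<le> k and l \<le> k.\<close>
        have "?B d k - face_poly a d F = (?B d k - u * ?B d' k)
            + w * (?B d' k - ?B d' m) + w * (?B d' m - ?g)
            + t * (?B d' k - ?B d' l) + t * (?B d' l - face_poly a d' ?C)"
          unfolding split gD u by algebra
        also have "coeffs_nonneg \<dots>"
          by (intro coeffs_nonneg_intros nn Suc_bound bound_poly_mono a mk lk conD conC)
        finally show ?thesis by (simp add: k_def)
      next
        case False
        define m where "m = top_h d ?D"
        \<comment> \<open>With no coloops in F, the deletion or the contraction, all three leading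
          coefficients are top coefficients, so the recursion makes them additive.\<close>
        have "\<not> coloop c ?C" for c using coloop_contraction[OF F e] nc by blast
        then have k: "k = m + l"
          unfolding k_def m_def l_def
          using top_h_no_coloops[OF F nc] top_h_no_coloops[OF D] top_h_no_coloops[OF C]
            coeff_Suc_face_poly[OF F', of d' e] False Suc by simp
        have conD: "coeffs_nonneg (?B d m - face_poly a d ?D)"
          unfolding m_def by (rule less.hyps[OF card_deletion_less[OF F e] D a])
        \<comment> \<open>The bound is affine in k, so passing from m to m + l adds l t u^d', which
          dominates t times the bound for the contraction.\<close>
        have Bk: "?B d k = ?B d m + of_int l * t * u ^ d'"
          unfolding Suc bound_poly.simps k t_def[symmetric] u_def[symmetric] of_int_diff of_int_add
          by algebra
        have "?B d k - face_poly a d F = (?B d m - face_poly a d ?D)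
            + t * (of_int l * u ^ d' - ?B d' l) + t * (?B d' l - face_poly a d' ?C)"
          unfolding split Bk by algebra
        also have "coeffs_nonneg \<dots>"
          by (intro coeffs_nonneg_intros nn conC conD bound_poly_le[OF a l1, folded u_def])
        finally show ?thesis by (simp add: k_def)
      qed
    qed
  qed
qed

section \<open>Translation to dimension, f-vector, h-vector and Euler characteristic\<close>

text \<open>Taking the union of the independent sets as ground set discards all loops.\<close>

lemma matroid_Union:
  assumes F: "matroid_rank d F"
  shows "matroid (\<Union>F) (\<lambda>X. X \<in> F)" and "loopless (\<Union>F) (\<lambda>X. X \<in> F)"
proof -
  have "finite (\<Union>F)" using family_finite[OF F] member_finite[OF F] by blast
  then show "matroid (\<Union>F) (\<lambda>X. X \<in> F)"
    by unfold_locales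
      (use empty_member[OF F] member_subset[OF F] member_augment[OF F] in blast)+
  show "loopless (\<Union>F) (\<lambda>X. X \<in> F)"
    using member_subset[OF F] by (fastforce simp: loopless_def)
qed

lemma complex_dim_matroid_rank:
  assumes F: "matroid_rank d F"
  shows "complex_dim F = int d - 1"
proof -
  obtain B where B: "B \<in> F" "card B = d" by (rule obtain_basis[OF F])
  show ?thesis
    unfolding complex_dim_def
  proof (rule Max_eqI)
    show "int d - 1 \<in> face_dim ` F"
      by (rule image_eqI[OF _ B(1)]) (simp add: face_dim_def B(2))
    show "y \<le> int d - 1" if "y \<in> face_dim ` F" for y
      using that member_card_le[OF F] by (force simp: face_dim_def)
  qed (simp add: family_finite[OF F])
qed

lemma matroid_rank_complex_dim:
  assumes "matroid E (\<lambda>X. X \<in> F)" "complex_dim F = int d - 1"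
  shows "matroid_rank d F"
proof -
  interpret matroid E "\<lambda>X. X \<in> F" by fact
  have "F \<subseteq> Pow E" using indep_subset_carrier by blast
  then have fin: "finite (face_dim ` F)" using carrier_finite by (auto intro: finite_subset)
  have "Max (face_dim ` F) \<in> face_dim ` F" using fin indep_empty by (intro Max_in) auto
  then have "\<exists>X\<in>F. card X = d" using assms(2) by (auto simp: complex_dim_def face_dim_def)
  moreover have "card X \<le> d" if "X \<in> F" for X
    using Max_ge[OF fin, of "face_dim X"] that assms(2) by (auto simp: complex_dim_def face_dim_def)
  ultimately show ?thesis using assms(1) by (auto simp: matroid_rank_def)
qed

text \<open>Stated over a general semiring because it is applied to polynomials for
  \<open>h_poly\<close> and to integers for the Euler characteristic.\<close>

lemma sum_by_card:
  fixes g :: "nat \<Rightarrow> 'b::comm_semiring_1"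
  assumes F: "matroid_rank d F"
  shows "(\<Sum>X\<in>F. g (card X)) = (\<Sum>i\<le>d. of_nat (f_vec F (int i - 1)) * g i)"
proof -
  have "(\<Sum>X\<in>F. g (card X)) = (\<Sum>i\<le>d. \<Sum>X | X \<in> F \<and> card X = i. g (card X))"
    by (rule sum.group[symmetric]) (use family_finite[OF F] member_card_le[OF F] in auto)
  also have "\<dots> = (\<Sum>i\<le>d. of_nat (f_vec F (int i - 1)) * g i)"
    by (intro sum.cong) (simp_all add: f_vec_def face_dim_def)
  finally show ?thesis .
qed

lemma h_poly_eq_face_poly:
  assumes "matroid_rank d F"
  shows "h_poly F = face_poly 0 d F"
  using sum_by_card[OF assms, of "\<lambda>i. [:0, 1:] ^ i * [:1, -1:] ^ (d - i) :: int poly"]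
  by (simp add: h_poly_def face_poly_def complex_dim_matroid_rank[OF assms] mult.assoc
      del: mult_pCons_left mult_pCons_right)

lemma coeff_X_power: "coeff ([:0, 1:] ^ n) i = (if n = i then 1 else (0 :: int))"
  using coeff_monom[of "1::int" n i] by (simp add: monom_altdef)

text \<open>At a = 1 the second factor is 1, so a face X contributes just t^|X|.\<close>

lemma coeff_face_poly_1:
  assumes F: "matroid_rank d F"
  shows "coeff (face_poly 1 d F) i = int (f_vec F (int i - 1))"
proof -
  have "coeff (face_poly 1 d F) i = (\<Sum>X\<in>F. if card X = i then 1 else 0)"
  proof -
    have "[:1, 1 - 1:] = (1 :: int poly)" by simp
    then show ?thesis
      by (simp only: face_poly_def Polynomial.coeff_sum coeff_X_power power_one mult_1_right)
  qed
  also have "\<dots> = (\<Sum>X | X \<in> F \<and> card X = i. 1)"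
    using family_finite[OF F] by (rule sum.inter_filter[symmetric])
  finally show ?thesis by (simp add: f_vec_def face_dim_def)
qed

text \<open>Each face contributes (-1)^(d - |X|) to the coefficient of t^d, so this coefficient is
  the Euler characteristic up to a global sign; its nonnegativity settles the sign.\<close>

lemma abs_reduced_euler_char:
  assumes F: "matroid_rank d F"
  shows "\<bar>reduced_euler_char F\<bar> = coeff (face_poly 0 d F) d"
proof -
  have "coeff ([:0, 1:] ^ card X * [:1, -1:] ^ (d - card X)) d = (- 1) ^ (d + 1) * (- 1 :: int) ^ (card X + 1)"
    if "X \<in> F" for X
  proof -
    have le: "card X \<le> d" by (rule member_card_le[OF F that])
    then have "coeff ([:0, 1:] ^ card X * [:1, -1:] ^ (d - card X)) d = (- 1 :: int) ^ (d - card X)"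
      by (simp add: monom_altdef[of 1, simplified, symmetric] coeff_monom_mult)
    \<comment> \<open>Adding an even number to the exponent removes the truncated subtraction and
      separates d from |X|.\<close>
    also have "\<dots> = (- 1) ^ (d - card X + 2 * (card X + 1))" by (simp add: power_add)
    also have "d - card X + 2 * (card X + 1) = (d + 1) + (card X + 1)" using le by simp
    finally show ?thesis by (simp only: power_add)
  qed
  then have "coeff (face_poly 0 d F) d = (- 1) ^ (d + 1) * (\<Sum>X\<in>F. (- 1) ^ (card X + 1))"
    unfolding face_poly_def coeff_sum sum_distrib_left by (intro sum.cong) simp_all
  also have "(\<Sum>X\<in>F. (- 1) ^ (card X + 1)) = reduced_euler_char F"
    using sum_by_card[OF F, of "\<lambda>i. (- 1 :: int) ^ (i + 1)"]
    by (simp add: reduced_euler_char_def complex_dim_matroid_rank[OF F] mult.commute)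
  finally have "\<bar>coeff (face_poly 0 d F) d\<bar> = \<bar>reduced_euler_char F\<bar>"
    by (simp add: abs_mult power_abs)
  then show ?thesis using face_poly_nonneg[OF F, of 0] by (simp add: coeffs_nonneg_def)
qed

lemma coeff_linear_1_power: "coeff ([:1, b:] ^ n) i = of_nat (n choose i) * (b::int) ^ i"
proof (cases "i \<le> n")
  case False
  have "degree ([:1, b:] ^ n) \<le> n"
    by (rule order.trans[OF degree_power_le]) simp
  then show ?thesis using False by (simp add: coeff_eq_0)
qed (simp add: coeff_linear_poly_power)

text \<open>For a = 0 and a = 1 this gives the right-hand sides of the h- and f-bounds. At i = 0 the
  exponent -1 occurs, but its binomial factor is 0.\<close>

lemma coeff_bound_poly:
  assumes "d > 0"
  shows "real_of_int (coeff (bound_poly a d k) i)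
    = binom d (int i) * (1 + of_int a) powi int i
      + (of_int k - 1) * binom (d - 1) (int i - 1) * (1 + of_int a) powi (int i - 1)"
proof -
  obtain d' where d: "d = Suc d'" using assms gr0_implies_Suc by blast
  have b: "bound_poly a d k = [:1, 1 + a:] ^ d + smult (k - 1) (pCons 0 ([:1, 1 + a:] ^ d'))"
    unfolding d bound_poly.simps by (simp add: of_int_poly)
  show ?thesis
  proof (cases i)
    case 0
    then show ?thesis unfolding b by (simp add: binom_def coeff_linear_1_power)
  next
    case (Suc j)
    have "nat (int i) = Suc j" "int i - 1 = int j" using Suc by simp_all
    then show ?thesis
      unfolding b coeff_add coeff_smult Suc coeff_pCons_Suc coeff_linear_1_power
      by (simp only: binom_def power_int_of_nat) (simp add: d)
  qed
qed

section \<open>Direct sums with rank 1 blocks and the extremal matroid\<close>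

text \<open>The direct sum with the uniform matroid of rank 1 on \<open>S\<close>.\<close>

definition add_block :: "'a set \<Rightarrow> 'a set set \<Rightarrow> 'a set set" where
  "add_block S F = {X. X - S \<in> F \<and> card (X \<inter> S) \<le> 1}"

context
  fixes d :: nat and F :: "'a set set" and S :: "'a set"
  assumes F: "matroid_rank d F" and S: "finite S" "S \<noteq> {}" "S \<inter> \<Union>F = {}"
begin

lemma add_block_eq: "add_block S F = F \<union> (\<lambda>(s, X). insert s X) ` (S \<times> F)"
proof (intro equalityI subsetI)
  fix X assume X: "X \<in> add_block S F"
  then have "card (X \<inter> S) = 0 \<or> card (X \<inter> S) = 1" by (auto simp: add_block_def)
  then consider "X \<inter> S = {}" | s where "X \<inter> S = {s}"
    using S(1) by (metis card_0_eq card_1_singletonE finite_Int)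
  then show "X \<in> F \<union> (\<lambda>(s, X). insert s X) ` (S \<times> F)"
  proof cases
    case 1
    then have "X - S = X" by auto
    then show ?thesis using X by (auto simp: add_block_def)
  next
    case 2
    then have "X = insert s (X - S)" "s \<in> S" by auto
    then show ?thesis using X by (auto simp: add_block_def image_iff)
  qed
next
  fix X assume "X \<in> F \<union> (\<lambda>(s, X). insert s X) ` (S \<times> F)"
  then consider "X \<in> F" | s Y where "s \<in> S" "Y \<in> F" "X = insert s Y" by auto
  then show "X \<in> add_block S F"
  proof cases
    case 1
    then have "X - S = X" "X \<inter> S = {}" using S by auto
    then show ?thesis using 1 by (simp add: add_block_def)
  next
    case 2
    then have "X - S = Y" "X \<inter> S = {s}" using S by auto
    then show ?thesis using 2(2) unfolding add_block_def mem_Collect_eq by simp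
  qed
qed

lemma matroid_rank_add_block: "matroid_rank (Suc d) (add_block S F)"
proof -
  obtain E where "matroid E (\<lambda>X. X \<in> F)" using F by (auto simp: matroid_rank_def)
  then interpret matroid E "\<lambda>X. X \<in> F" .
  have card: "card X = card (X - S) + card (X \<inter> S)" if "X \<in> add_block S F" for X
  proof -
    have "finite (X - S)" using that member_finite[OF F] by (auto simp: add_block_def)
    then have "card ((X - S) \<union> (X \<inter> S)) = card (X - S) + card (X \<inter> S)"
      using S by (intro card_Un_disjoint) auto
    then show ?thesis by (simp add: Un_Diff_Int)
  qed
  have "matroid (E \<union> S) (\<lambda>X. X \<in> add_block S F)"
  proof
    show "finite (E \<union> S)" using carrier_finite S by simp
    show "{} \<in> add_block S F" using indep_empty by (simp add: add_block_def)
    show "X \<subseteq> E \<union> S" if "X \<in> add_block S F" for X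
      using that indep_subset_carrier[of "X - S"] by (auto simp: add_block_def)
    show "Y \<in> add_block S F" if "X \<in> add_block S F" "Y \<subseteq> X" for X Y
    proof -
      have "Y - S \<in> F" using that indep_subset[of "X - S" "Y - S"] by (auto simp: add_block_def)
      moreover have "card (Y \<inter> S) \<le> card (X \<inter> S)" using that S by (intro card_mono) auto
      ultimately show ?thesis using that S by (auto simp: add_block_def)
    qed
    fix X Y assume XY: "X \<in> add_block S F" "Y \<in> add_block S F" "card X < card Y"
    show "\<exists>y\<in>Y - X. insert y X \<in> add_block S F"
    \<comment> \<open>Either augmentation takes place in F, leaving the block part unchanged, or Y
      must exceed X inside S; then X misses S and any element of Y \<inter> S can be added.\<close>
    proof (cases "card (X - S) < card (Y - S)")
      case True
      then obtain y where y: "y \<in> (Y - S) - (X - S)" "insert y (X - S) \<in> F"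
        using augment[of "X - S" "Y - S"] XY by (auto simp: add_block_def)
      then have "insert y X - S = insert y (X - S)" "insert y X \<inter> S = X \<inter> S" by auto
      then have "insert y X \<in> add_block S F"
        using y(2) XY(1) unfolding add_block_def mem_Collect_eq by (simp only:)
      then show ?thesis using y by blast
    next
      case False
      then have "card (X \<inter> S) < card (Y \<inter> S)" using card[OF XY(1)] card[OF XY(2)] XY(3) by linarith
      moreover have "card (Y \<inter> S) \<le> 1" using XY by (simp add: add_block_def)
      ultimately have "card (X \<inter> S) = 0" "card (Y \<inter> S) \<noteq> 0" by auto
      then have X: "X \<inter> S = {}" and "Y \<inter> S \<noteq> {}" using S by auto
      then obtain y where y: "y \<in> Y" "y \<in> S" by blast
      then have "insert y X - S = X - S" "insert y X \<inter> S = {y}" using X by auto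
      then have "insert y X \<in> add_block S F"
        using XY(1) unfolding add_block_def mem_Collect_eq by simp
      then show ?thesis using y X by blast
    qed
  qed
  moreover have "card X \<le> Suc d" if "X \<in> add_block S F" for X
    using card[OF that] that member_card_le[OF F, of "X - S"] by (auto simp: add_block_def)
  moreover obtain B where B: "B \<in> F" "card B = d" by (rule obtain_basis[OF F])
  obtain s where "s \<in> S" using S by blast
  then have "insert s B \<in> add_block S F" "card (insert s B) = Suc d"
    using B S member_finite[OF F B(1)] by (auto simp: add_block_eq card_insert_if)
  ultimately show ?thesis by (auto simp: matroid_rank_def)
qed

text \<open>Faces of F gain the factor 1 + (a - 1) t from the larger rank, and each of the |S| ways
  to add a block element gives a factor t.\<close>

lemma face_poly_add_block:
  "face_poly a (Suc d) (add_block S F) = [:1, int (card S) - 1 + a:] * face_poly a d F"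
proof -
  let ?g = "\<lambda>X. [:0, 1:] ^ card X * [:1, a - 1:] ^ (Suc d - card X)"
  let ?h = "\<lambda>X. [:0, 1:] ^ card X * [:1, a - 1:] ^ (d - card X)"
  let ?I = "(\<lambda>(s, X). insert s X) ` (S \<times> F)"
  have fin: "finite F" by (rule family_finite[OF F])
  have "sum ?g (add_block S F) = sum ?g F + sum ?g ?I"
    unfolding add_block_eq by (rule sum.union_disjoint) (use fin S in auto)
  also have "sum ?g F = [:1, a - 1:] * sum ?h F"
    unfolding sum_distrib_left using member_card_le[OF F]
    by (intro sum.cong) (simp_all only: Suc_diff_le power_Suc mult.left_commute)
  also have "sum ?g ?I = (\<Sum>(s, X)\<in>S \<times> F. ?g (insert s X))"
  proof (subst sum.reindex)
    show "inj_on (\<lambda>(s, X). insert s X) (S \<times> F)"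
    proof (rule inj_onI, clarify)
      fix s X t Y assume *: "s \<in> S" "X \<in> F" "t \<in> S" "Y \<in> F" "insert s X = insert t Y"
      then have "X = insert s X - S" "Y = insert t Y - S" "insert s X \<inter> S = {s}" "insert t Y \<inter> S = {t}"
        using S(3) by auto
      then show "s = t \<and> X = Y" unfolding *(5) by simp
    qed
  qed (simp add: case_prod_beta comp_def)
  also have "\<dots> = (\<Sum>(s, X)\<in>S \<times> F. [:0, 1:] * ?h X)"
  proof (rule sum.cong[OF refl], clarify)
    fix s X assume "s \<in> S" "X \<in> F"
    then have "card (insert s X) = Suc (card X)"
      using S member_finite[OF F] by (intro card_insert_disjoint) auto
    then show "?g (insert s X) = [:0, 1:] * ?h X" by (simp only: power_Suc diff_Suc_Suc mult.assoc)
  qed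
  also have "\<dots> = of_nat (card S) * ([:0, 1:] * sum ?h F)"
    unfolding sum.cartesian_product[symmetric] sum_constant sum_distrib_left ..
  also have "[:1, a - 1:] * sum ?h F + of_nat (card S) * ([:0, 1:] * sum ?h F)
      = ([:1, a - 1:] + of_nat (card S) * [:0, 1:]) * sum ?h F"
    by (simp only: distrib_right mult.assoc)
  also have "[:1, a - 1:] + of_nat (card S) * [:0, 1:] = [:1, int (card S) - 1 + a:]"
    by (simp add: of_nat_poly)
  finally show ?thesis by (simp only: face_poly_def)
qed

end

lemma obtain_fresh_block:
  fixes F :: "nat set set"
  assumes F: "matroid_rank d F" and "m > 0"
  obtains S where "finite S" "S \<noteq> {}" "S \<inter> \<Union>F = {}" "card S = m"
proof -
  have "finite (\<Union>F)" using family_finite[OF F] member_finite[OF F] by blast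
  then have "infinite (UNIV - \<Union>F)" by (rule Diff_infinite_finite) (rule infinite_UNIV_nat)
  from infinite_arbitrarily_large[OF this, of m]
  obtain S where S: "finite S" "card S = m" "S \<subseteq> UNIV - \<Union>F" by blast
  show ?thesis
  proof (rule that[OF S(1) _ _ S(2)])
    show "S \<noteq> {}" using S(2) \<open>m > 0\<close> by force
    show "S \<inter> \<Union>F = {}" using S(3) by blast
  qed
qed

lemma matroid_rank_trivial: "matroid_rank 0 {{}}"
proof -
  have "matroid {} (\<lambda>X. X \<in> {{}})" by unfold_locales auto
  then show ?thesis by (auto simp: matroid_rank_def)
qed

text \<open>Each block of size 2 contributes 1 + (1 + a) t. The complex is the boundary of the
  cross-polytope. One F serves all a, so the h- and f-equalities will hold for the same
  matroid.\<close>

lemma cross_polytope_matroid: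
  "\<exists>F :: nat set set. matroid_rank d F \<and> (\<forall>a. face_poly a d F = [:1, 1 + a:] ^ d)"
proof (induction d)
  case 0
  then show ?case using matroid_rank_trivial face_poly_rank_0 by fastforce
next
  case (Suc d)
  then obtain F :: "nat set set" where F: "matroid_rank d F" "\<And>a. face_poly a d F = [:1, 1 + a:] ^ d"
    by blast
  obtain S where S: "finite S" "S \<noteq> {}" "S \<inter> \<Union>F = {}" "card S = 2"
    by (rule obtain_fresh_block[OF F(1), of 2]) auto
  have "face_poly a (Suc d) (add_block S F) = [:1, 1 + a:] ^ Suc d" for a
    unfolding face_poly_add_block[OF F(1) S(1-3)] F(2) S(4) power_Suc
    by (rule arg_cong2[where f = "(*)"]) simp_all
  then show ?case using matroid_rank_add_block[OF F(1) S(1-3)] by blast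
qed

text \<open>A final block of size k + 1 has factor 1 + (k + a) t = (1 + (1 + a) t) + (k - 1) t,
  which produces the two terms of the bound.\<close>

lemma extremal_matroid:
  assumes "d > 0" "k > 0"
  shows "\<exists>F :: nat set set. matroid_rank d F \<and> (\<forall>a. face_poly a d F = bound_poly a d (int k))"
proof -
  obtain d' where d: "d = Suc d'" using assms gr0_implies_Suc by blast
  obtain F :: "nat set set" where F: "matroid_rank d' F" "\<And>a. face_poly a d' F = [:1, 1 + a:] ^ d'"
    using cross_polytope_matroid by blast
  obtain S where S: "finite S" "S \<noteq> {}" "S \<inter> \<Union>F = {}" "card S = k + 1"
    by (rule obtain_fresh_block[OF F(1), of "k + 1"]) auto
  have "face_poly a d (add_block S F) = bound_poly a d (int k)" for a
  proof -
    have "[:1, int (card S) - 1 + a:] = [:1, 1 + a:] + of_int (int k - 1) * [:0, 1:]"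
      by (simp add: S(4) of_int_poly)
    then show ?thesis
      unfolding d face_poly_add_block[OF F(1) S(1-3)] F(2) bound_poly.simps power_Suc
      by (simp only: distrib_right)
  qed
  then show ?thesis using matroid_rank_add_block[OF F(1) S(1-3), folded d] by blast
qed

section \<open>The inequalities and their tightness\<close>

lemma h_vec_eq:
  assumes "matroid_rank d F"
  shows "h_vec F i = coeff (face_poly 0 d F) i"
  by (simp add: h_vec_def h_poly_eq_face_poly[OF assms])

lemma f_vec_eq:
  assumes "matroid_rank d F" "- 1 \<le> i"
  shows "int (f_vec F i) = coeff (face_poly 1 d F) (nat (i + 1))"
  using coeff_face_poly_1[OF assms(1), of "nat (i + 1)"] assms(2) by simp

theorem theorem3p3:
  fixes d k :: nat
  assumes "d > 0" and "k > 0"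
  shows
    "(\<forall>(E :: 'a set) indep.
        matroid E indep \<and> loopless E indep \<and>
        complex_dim (independence_complex indep) = int d - 1 \<and>
        \<bar>reduced_euler_char (independence_complex indep)\<bar> = int k \<longrightarrow>
          (\<forall>i::nat. i \<le> d \<longrightarrow>
             real_of_int (h_vec (independence_complex indep) i)
               \<le> binom d (int i) + (real k - 1) * binom (d - 1) (int i - 1)) \<and>
          (\<forall>i::int. - 1 \<le> i \<and> i \<le> int d - 1 \<longrightarrow>
             real (f_vec (independence_complex indep) i)
               \<le> binom d (i + 1) * 2 powi (i + 1) + (real k - 1) * binom (d - 1) i * 2 powi i)) \<and>
     (\<exists>(E :: nat set) indep.
        matroid E indep \<and> loopless E indep \<and>
        complex_dim (independence_complex indep) = int d - 1 \<and>
        \<bar>reduced_euler_char (independence_complex indep)\<bar> = int k \<and>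
          (\<forall>i::nat. i \<le> d \<longrightarrow>
             real_of_int (h_vec (independence_complex indep) i)
               = binom d (int i) + (real k - 1) * binom (d - 1) (int i - 1)) \<and>
          (\<forall>i::int. - 1 \<le> i \<and> i \<le> int d - 1 \<longrightarrow>
             real (f_vec (independence_complex indep) i)
               = binom d (i + 1) * 2 powi (i + 1) + (real k - 1) * binom (d - 1) i * 2 powi i))"
proof -
  have h_bound: "binom d (int i) + (real k - 1) * binom (d - 1) (int i - 1)
      = real_of_int (coeff (bound_poly 0 d (int k)) i)" for i
    unfolding coeff_bound_poly[OF assms(1)] by simp
  have f_bound: "binom d (i + 1) * 2 powi (i + 1) + (real k - 1) * binom (d - 1) i * 2 powi i
      = real_of_int (coeff (bound_poly 1 d (int k)) (nat (i + 1)))" if "- 1 \<le> i" for i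
    unfolding coeff_bound_poly[OF assms(1)] using that by simp
  have f_real: "real (f_vec F i) = real_of_int (coeff (face_poly 1 d F) (nat (i + 1)))"
    if "matroid_rank d F" "- 1 \<le> i" for F :: "'b set set" and i
    unfolding f_vec_eq[OF that, symmetric] by simp
  have upper: "coeff (face_poly a d F) i \<le> coeff (bound_poly a d (int k)) i"
    if "matroid E (\<lambda>X. X \<in> F)" "complex_dim F = int d - 1" "\<bar>reduced_euler_char F\<bar> = int k" "0 \<le> a"
    for E :: "'a set" and F a i
  proof -
    have F: "matroid_rank d F" by (rule matroid_rank_complex_dim[OF that(1,2)])
    have top: "coeff (face_poly 0 d F) d = int k" using abs_reduced_euler_char[OF F] that(3) by simp
    \<comment> \<open>Since k > 0, the coefficient of t^d is nonzero and hence leading; this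
      identifies k with \<open>top_h d F\<close>.\<close>
    then have "degree (face_poly 0 d F) = d"
      using degree_face_poly[OF F, of 0] le_degree[of "face_poly 0 d F" d] \<open>k > 0\<close> by simp
    then have "top_h d F = int k" using top by simp
    then show ?thesis
      using face_poly_le_bound_poly[OF F \<open>0 \<le> a\<close>] by (simp add: coeffs_nonneg_def)
  qed
  obtain F :: "nat set set" where F: "matroid_rank d F"
    and eq: "\<And>a. face_poly a d F = bound_poly a d (int k)"
    using extremal_matroid[OF assms] by blast
  \<comment> \<open>The top coefficient is 1 + (k - 1), both binomials being on the diagonal; so the
    extremal matroid has the prescribed Euler characteristic.\<close>
  have "coeff (bound_poly 0 d (int k)) d = int k"
  proof -
    have diag: "binom n (int n) = 1" for n by (simp add: binom_def)
    have "int d - 1 = int (d - 1)" using assms by simp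
    then have "binom (d - 1) (int d - 1) = 1" by (simp only: diag)
    then have "real_of_int (coeff (bound_poly 0 d (int k)) d) = real k"
      unfolding h_bound[of d, symmetric] by (simp add: diag)
    then show ?thesis by linarith
  qed
  then have char: "\<bar>reduced_euler_char F\<bar> = int k"
    using abs_reduced_euler_char[OF F] eq by simp
  have lower: "\<exists>(E :: nat set) indep.
        matroid E indep \<and> loopless E indep \<and>
        complex_dim (independence_complex indep) = int d - 1 \<and>
        \<bar>reduced_euler_char (independence_complex indep)\<bar> = int k \<and>
          (\<forall>i::nat. i \<le> d \<longrightarrow>
             real_of_int (h_vec (independence_complex indep) i)
               = binom d (int i) + (real k - 1) * binom (d - 1) (int i - 1)) \<and>
          (\<forall>i::int. - 1 \<le> i \<and> i \<le> int d - 1 \<longrightarrow>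
             real (f_vec (independence_complex indep) i)
               = binom d (i + 1) * 2 powi (i + 1) + (real k - 1) * binom (d - 1) i * 2 powi i)"
  proof (intro exI[of _ "\<Union>F"] exI[of _ "\<lambda>X. X \<in> F"] conjI allI impI)
    have F_eq: "independence_complex (\<lambda>X. X \<in> F) = F" by (simp add: independence_complex_def)
    show "complex_dim (independence_complex (\<lambda>X. X \<in> F)) = int d - 1"
      unfolding F_eq by (rule complex_dim_matroid_rank[OF F])
    show "\<bar>reduced_euler_char (independence_complex (\<lambda>X. X \<in> F))\<bar> = int k"
      unfolding F_eq by (rule char)
    show "real_of_int (h_vec (independence_complex (\<lambda>X. X \<in> F)) i)
        = binom d (int i) + (real k - 1) * binom (d - 1) (int i - 1)" for i
      unfolding F_eq h_bound h_vec_eq[OF F] eq ..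
    show "real (f_vec (independence_complex (\<lambda>X. X \<in> F)) i)
        = binom d (i + 1) * 2 powi (i + 1) + (real k - 1) * binom (d - 1) i * 2 powi i"
      if "- 1 \<le> i \<and> i \<le> int d - 1" for i
      unfolding F_eq f_bound[OF conjunct1[OF that]] f_real[OF F conjunct1[OF that]] eq ..
  qed (rule matroid_Union[OF F])+
  show ?thesis
  proof (rule conjI[OF _ lower], intro allI impI conjI)
    fix E :: "'a set" and indep :: "'a set \<Rightarrow> bool"
    let ?F = "independence_complex indep"
    assume *: "matroid E indep \<and> loopless E indep \<and> complex_dim ?F = int d - 1
      \<and> \<bar>reduced_euler_char ?F\<bar> = int k"
    then have mat: "matroid E (\<lambda>X. X \<in> ?F)" by (simp add: independence_complex_def)
    have rank: "matroid_rank d ?F" using matroid_rank_complex_dim[OF mat] * by blast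
    have le: "real_of_int (coeff (face_poly a d ?F) i) \<le> real_of_int (coeff (bound_poly a d (int k)) i)"
      if "0 \<le> a" for a i
      unfolding of_int_le_iff using upper[OF mat _ _ that] * by blast
    show "real_of_int (h_vec ?F i) \<le> binom d (int i) + (real k - 1) * binom (d - 1) (int i - 1)" for i
      unfolding h_bound h_vec_eq[OF rank] by (rule le) simp
    show "real (f_vec ?F i)
        \<le> binom d (i + 1) * 2 powi (i + 1) + (real k - 1) * binom (d - 1) i * 2 powi i"
      if "- 1 \<le> i \<and> i \<le> int d - 1" for i
      unfolding f_bound[OF conjunct1[OF that]] f_real[OF rank conjunct1[OF that]] by (rule le) simp
  qed
qed

end
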